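(* Let $s\geq 2$ be an integer and $0<\theta_1,\dots,\theta_s\leq 1$ with $\theta_1+\dots+\theta_s>1$. There exist positive constants $c(\theta_1,\dots,\theta_s)$ and $M(\theta_1,\dots,\theta_s)$ depending only on $\theta_1,\dots,\theta_s$ such that the following holds. If $W=\prod_i p_i^{n_i}$ is a positive integer with $p_i\geq M(\theta_1,\dots,\theta_s)$ for all $i$, and $A_1,\dots,A_s\subseteq\mathbb{Z}/W$ satisfy $|A_j|\geq\theta_jW$ for all $1\leq j\leq s$, then \[ 1_{A_1}*1_{A_2}*\dots*1_{A_s}(x)\geq c(\theta_1,\dots,\theta_s)\,W^{s-1}\quad\text{for all } x\in\mathbb{Z}/W. \]
   Context: Convolution on $\mathbb{Z}/W$ is with respect to counting measure: $f*g(x)=\sum_{y+z=x}f(y)g(z)$; $1_A$ is the indicator function of $A$. *)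

theory Defs
  imports "HOL-Number_Theory.Residues" "HOL-Library.Indicator_Function"
begin

definition convolution ::
    "('a, 'b) ring_scheme \<Rightarrow> ('a \<Rightarrow> real) \<Rightarrow> ('a \<Rightarrow> real) \<Rightarrow> 'a \<Rightarrow> real" where
  "convolution R f g x =
     (\<Sum>(y, z) \<in> {(y, z). y \<in> carrier R \<and> z \<in> carrier R \<and> y \<oplus>\<^bsub>R\<^esub> z = x}. f y * g z)"

text \<open>Bracketed to the left: \<open>(\<dots>((f 1 * f 2) * f 3)\<dots>) * f s\<close>; meaningful for \<open>s \<ge> 1\<close>.\<close>

definition iterated_convolution ::
    "('a, 'b) ring_scheme \<Rightarrow> nat \<Rightarrow> (nat \<Rightarrow> 'a \<Rightarrow> real) \<Rightarrow> 'a \<Rightarrow> real" where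
  "iterated_convolution R s f = foldl (convolution R) (f 1) (map f [2..<Suc s])"

text \<open>The group \<open>\<int>/W\<close> is rendered by the library's \<^term>\<open>residue_ring (int W)\<close>, whose elements
  are the integers \<open>0, \<dots>, W - 1\<close> under addition modulo \<open>W\<close>. Its carrier and addition are
  correct for \<open>W = 1\<close> too (only its unit is not), so \<open>W = 1\<close>, the empty product of primes,
  needs no exception.\<close>

end

theory Submission
  imports Defs
begin

text \<open>
  If all proper subgroups of \<open>G\<close> have at most \<open>D\<close> elements, Pollard's theorem holds in \<open>G\<close> with an
  error \<open>D\<close>. With \<open>t\<close> a small multiple of \<open>|G|\<close> it shows that the set of \<open>x\<close> with at least
  \<open>\<epsilon> |G|\<close> representations \<open>x = a + b\<close> has size almost \<open>min |G| (|A| + |B|)\<close>. In \<open>\<int>/W\<close> a proper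
  subgroup has at most \<open>W / M\<close> elements, since its index is divisible by a prime factor of \<open>W\<close>.
  Adding the sets one at a time, the popular values of the sum of all but the last set have
  density more than \<open>1 - \<theta>\<^sub>s\<close>, and for the last set the pigeonhole principle suffices.
\<close>

section \<open>Convolutions of indicator functions on a finite abelian group\<close>

locale finite_abelian_group = abelian_group R for R (structure) +
  assumes finite_carrier [simp]: "finite (carrier R)"
begin

lemma sum_minus_right:
  fixes h :: "'a \<Rightarrow> real"
  assumes "g \<in> carrier R"
  shows "(\<Sum>x\<in>carrier R. h (x \<ominus> g)) = (\<Sum>x\<in>carrier R. h x)"
proof (rule sum.reindex_bij_witness[where i = "\<lambda>y. y \<oplus> g" and j = "\<lambda>x. x \<ominus> g"])
qed (use assms in \<open>auto simp: minus_eq a_assoc l_neg r_neg\<close>)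

lemma sum_minus_left:
  fixes h :: "'a \<Rightarrow> real"
  assumes "g \<in> carrier R"
  shows "(\<Sum>x\<in>carrier R. h (g \<ominus> x)) = (\<Sum>x\<in>carrier R. h x)"
proof (rule sum.reindex_bij_witness[where i = "\<lambda>x. g \<ominus> x" and j = "\<lambda>x. g \<ominus> x"])
  have *: "g \<ominus> (g \<ominus> x) = x" if "x \<in> carrier R" for x
    using assms that by (simp add: minus_eq minus_add r_neg1 r_neg2)
  show "g \<ominus> (g \<ominus> x) = x" "g \<ominus> (g \<ominus> x) = x" if "x \<in> carrier R" for x
    using * that by auto
qed (use assms in auto)

lemma convolution_eq_sum:
  assumes "x \<in> carrier R"
  shows "convolution R f g x = (\<Sum>y\<in>carrier R. f y * g (x \<ominus> y))"
  unfolding convolution_def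
proof (rule sum.reindex_bij_witness[where i = "\<lambda>y. (y, x \<ominus> y)" and j = fst])
  have cancel: "y \<oplus> z \<ominus> y = z" if "y \<in> carrier R" "z \<in> carrier R" for y z
    using that by (subst a_comm[of y z]) (auto simp: minus_eq a_assoc r_neg)
  show "(fst p, x \<ominus> fst p) = p"
    if "p \<in> {(y, z). y \<in> carrier R \<and> z \<in> carrier R \<and> y \<oplus> z = x}" for p
    using that by (auto simp: cancel)
  show "(y, x \<ominus> y) \<in> {(y, z). y \<in> carrier R \<and> z \<in> carrier R \<and> y \<oplus> z = x}"
    if "y \<in> carrier R" for y
    using that assms by (auto simp: minus_eq a_lcomm[of y x] r_neg)
  show "f (fst p) * g (x \<ominus> fst p) = (case p of (y, z) \<Rightarrow> f y * g z)"
    if "p \<in> {(y, z). y \<in> carrier R \<and> z \<in> carrier R \<and> y \<oplus> z = x}" for p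
    using that by (auto simp: cancel)
qed auto

lemma convolution_commute:
  assumes "x \<in> carrier R"
  shows "convolution R f g x = convolution R g f x"
proof -
  have "x \<ominus> (x \<ominus> y) = y" if "y \<in> carrier R" for y
    using assms that by (simp add: minus_eq minus_add r_neg1 r_neg2)
  then have "(\<Sum>y\<in>carrier R. f y * g (x \<ominus> y)) = (\<Sum>y\<in>carrier R. f (x \<ominus> (x \<ominus> y)) * g (x \<ominus> y))"
    by simp
  also have "\<dots> = (\<Sum>y\<in>carrier R. f (x \<ominus> y) * g y)"
    by (rule sum_minus_left[OF assms])
  finally show ?thesis
    by (simp add: convolution_eq_sum assms mult.commute)
qed

lemma sum_indicator_carrier:
  "A \<subseteq> carrier R \<Longrightarrow> (\<Sum>x\<in>carrier R. indicator A x :: real) = card A"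
  using sum_mult_indicator[of "carrier R" "\<lambda>_. 1 :: real" A] by (simp add: Int_absorb1)

lemma convolution_indicator_nonneg: "convolution R (indicator A) (indicator B) x \<ge> (0::real)"
  unfolding convolution_def by (rule sum_nonneg) auto

lemma sum_convolution_indicator:
  assumes "A \<subseteq> carrier R" "B \<subseteq> carrier R"
  shows "(\<Sum>x\<in>carrier R. convolution R (indicator A) (indicator B) x) = card A * card B"
proof -
  have "(\<Sum>x\<in>carrier R. convolution R (indicator A) (indicator B) x)
      = (\<Sum>x\<in>carrier R. \<Sum>y\<in>carrier R. indicator A y * indicator B (x \<ominus> y))"
    by (simp add: convolution_eq_sum)
  also have "\<dots> = (\<Sum>y\<in>carrier R. indicator A y * (\<Sum>x\<in>carrier R. indicator B (x \<ominus> y)))"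
    by (subst sum.swap) (simp add: sum_distrib_left)
  also have "\<dots> = (\<Sum>y\<in>carrier R. indicator A y * real (card B))"
    by (intro sum.cong refl) (simp add: sum_minus_right sum_indicator_carrier assms)
  finally show ?thesis
    by (simp add: sum_distrib_right[symmetric] sum_indicator_carrier assms)
qed

lemma convolution_indicator_le_card:
  assumes "A \<subseteq> carrier R" "B \<subseteq> carrier R" "x \<in> carrier R"
  shows "convolution R (indicator A) (indicator B) x \<le> card B"
proof -
  have "convolution R (indicator A) (indicator B) x \<le> (\<Sum>y\<in>carrier R. indicator B (x \<ominus> y))"
    unfolding convolution_eq_sum[OF assms(3)]
    by (intro sum_mono) (auto simp: indicator_def)
  then show ?thesis
    by (simp add: sum_minus_left sum_indicator_carrier assms)
qed

text \<open>Pigeonhole principle: each product of indicators is at least their sum minus 1. It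
  settles the case of large sets in \<open>Pollard\<close> and handles the last set in the final
  theorem.\<close>

lemma convolution_indicator_ge:
  assumes "A \<subseteq> carrier R" "B \<subseteq> carrier R" "x \<in> carrier R"
  shows "convolution R (indicator A) (indicator B) x
    \<ge> real (card A) + real (card B) - real (card (carrier R))"
proof -
  have "convolution R (indicator A) (indicator B) x
      \<ge> (\<Sum>y\<in>carrier R. indicator A y + indicator B (x \<ominus> y) - 1)"
    unfolding convolution_eq_sum[OF assms(3)]
    by (intro sum_mono) (auto simp: indicator_def)
  then show ?thesis
    by (simp add: sum.distrib sum_subtractf sum_minus_left sum_indicator_carrier assms)
qed

text \<open>With \<open>I = A \<inter> B\<close>, \<open>A' = A - B\<close> and \<open>B' = B - A\<close> this is the commutative ring identity
  \<open>(I + A') (I + B') = (I + A' + B') I + A' B'\<close>.\<close>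

lemma convolution_indicator_Dyson:
  assumes x: "x \<in> carrier R"
  shows "convolution R (indicator A) (indicator B) x
    = convolution R (indicator (A \<union> B)) (indicator (A \<inter> B)) x
      + convolution R (indicator (A - B)) (indicator (B - A)) x"
proof -
  have split: "indicator A = (\<lambda>z. indicator (A \<inter> B) z + indicator (A - B) z :: real)"
    "indicator B = (\<lambda>z. indicator (A \<inter> B) z + indicator (B - A) z :: real)"
    "indicator (A \<union> B)
      = (\<lambda>z. indicator (A \<inter> B) z + indicator (A - B) z + indicator (B - A) z :: real)"
    by (auto simp: fun_eq_iff indicator_def)
  have add_left: "convolution R (\<lambda>z. f z + f' z) g x = convolution R f g x + convolution R f' g x"
    and add_right: "convolution R g (\<lambda>z. f z + f' z) x = convolution R g f x + convolution R g f' x"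
    for f f' g
    using x by (simp_all add: convolution_eq_sum algebra_simps sum.distrib)
  have "convolution R (indicator A) (indicator B) x
      = convolution R (\<lambda>z. indicator (A \<inter> B) z + indicator (A - B) z)
          (\<lambda>z. indicator (A \<inter> B) z + indicator (B - A) z) x"
    using arg_cong2[OF split(1,2), of "\<lambda>f g. convolution R f g x"] .
  moreover have "convolution R (indicator (A \<union> B)) (indicator (A \<inter> B)) x
      = convolution R (\<lambda>z. indicator (A \<inter> B) z + indicator (A - B) z + indicator (B - A) z)
          (indicator (A \<inter> B)) x"
    using arg_cong[OF split(3), of "\<lambda>f. convolution R f (indicator (A \<inter> B)) x"] .
  \<comment> \<open>Expanding the two products leaves the mixed term of \<open>A \<inter> B\<close>
    and \<open>B - A\<close> in opposite orders.\<close>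
  moreover have "convolution R (indicator (B - A)) (indicator (A \<inter> B)) x
      = convolution R (indicator (A \<inter> B)) (indicator (B - A)) x"
    by (rule convolution_commute[OF x])
  ultimately show ?thesis
    by (simp add: add_left add_right)
qed

section \<open>Translates, stabilizers and Pollard's theorem\<close>

lemma card_translate:
  assumes "B \<subseteq> carrier R" "g \<in> carrier R"
  shows "card ((\<lambda>b. b \<oplus> g) ` B) = card B"
  by (rule card_image) (use assms in \<open>auto simp: inj_on_def subset_iff\<close>)

text \<open>Translating \<open>B\<close> only translates the convolution, so sums over the whole
  group do not change. This lets \<open>Pollard\<close> replace \<open>B\<close> by a translate in
  favourable position to \<open>A\<close>.\<close>

lemma convolution_indicator_translate:
  assumes "B \<subseteq> carrier R" "g \<in> carrier R" "x \<in> carrier R"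
  shows "convolution R (indicator A) (indicator ((\<lambda>b. b \<oplus> g) ` B)) x
    = convolution R (indicator A) (indicator B) (x \<ominus> g)"
proof -
  have "indicator ((\<lambda>b. b \<oplus> g) ` B) (x \<ominus> y) = (indicator B (x \<ominus> g \<ominus> y) :: real)"
    if y: "y \<in> carrier R" for y
  proof -
    have "x \<ominus> y = b \<oplus> g \<longleftrightarrow> x \<ominus> g \<ominus> y = b" if "b \<in> carrier R" for b
    proof
      show "x \<ominus> g \<ominus> y = b" if "x \<ominus> y = b \<oplus> g"
      proof -
        have "x \<ominus> g \<ominus> y = (x \<ominus> y) \<ominus> g"
          using y assms by (simp add: minus_eq a_ac)
        then show ?thesis
          using that \<open>b \<in> carrier R\<close> assms by (simp add: minus_eq a_assoc r_neg)
      qed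
      show "x \<ominus> y = b \<oplus> g" if "x \<ominus> g \<ominus> y = b"
      proof -
        have "b \<oplus> g = (x \<ominus> y) \<oplus> (\<ominus> g \<oplus> g)"
          using y assms that[symmetric] by (simp add: minus_eq a_ac)
        then show ?thesis
          using y assms by (simp add: l_neg)
      qed
    qed
    then have "x \<ominus> y \<in> (\<lambda>b. b \<oplus> g) ` B \<longleftrightarrow> x \<ominus> g \<ominus> y \<in> B"
      using assms(1) by blast
    then show ?thesis
      by (simp add: indicator_def)
  qed
  then show ?thesis
    using assms by (simp add: convolution_eq_sum)
qed

text \<open>The stabilizer of \<open>A\<close> is the subgroup to which the bound \<open>D\<close>
  is applied in \<open>Pollard\<close>. For inverses, the condition on \<open>h\<close> is read at
  the point \<open>x \<oplus> \<ominus> h\<close>.\<close>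

lemma additive_subgroup_stabilizer:
  assumes "A \<subseteq> carrier R"
  shows "additive_subgroup {h \<in> carrier R. \<forall>x\<in>carrier R. x \<oplus> h \<in> A \<longleftrightarrow> x \<in> A} R"
    (is "additive_subgroup ?H R")
proof (rule additive_subgroup.intro, rule add.subgroupI)
  show "?H \<subseteq> carrier R" by auto
  have "\<zero> \<in> ?H" by simp
  then show "?H \<noteq> {}" by blast
  show "\<ominus> h \<in> ?H" if h: "h \<in> ?H" for h
  proof -
    have "x \<oplus> \<ominus> h \<in> A \<longleftrightarrow> x \<in> A" if "x \<in> carrier R" for x
    proof -
      have "x \<oplus> \<ominus> h \<oplus> h = x" using h that by (simp add: a_assoc l_neg)
      moreover have "x \<oplus> \<ominus> h \<in> carrier R" using h that by simp
      moreover have "y \<oplus> h \<in> A \<longleftrightarrow> y \<in> A" if "y \<in> carrier R" for y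
        using h that by simp
      ultimately show ?thesis by metis
    qed
    with h show ?thesis by simp
  qed
  show "h \<oplus> k \<in> ?H" if "h \<in> ?H" "k \<in> ?H" for h k
    using that by (auto simp: a_assoc[symmetric])
qed

text \<open>The version of Pollard's theorem used by Green and Ruzsa. If some translate \<open>C\<close> of \<open>B\<close> meets \<open>A\<close>
  but is not contained in it, the Dyson transform reduces \<open>B\<close>; otherwise \<open>B\<close> lies in a coset of the
  stabilizer of \<open>A\<close>. The case \<open>|A \<inter> C| < t\<close> splits the truncation level as \<open>|A \<inter> C| + (t - |A \<inter> C|)\<close>.\<close>

lemma Pollard:
  fixes t D :: real
  assumes D: "D \<ge> 0" "\<And>H. additive_subgroup H R \<Longrightarrow> H \<noteq> carrier R \<Longrightarrow> card H \<le> D"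
    and "A \<subseteq> carrier R" "B \<subseteq> carrier R" "0 \<le> t" "t \<le> card A" "t \<le> card B"
  shows "(\<Sum>x\<in>carrier R. min t (convolution R (indicator A) (indicator B) x))
    \<ge> t * min (card (carrier R)) (real (card A) + real (card B) - t - D)"
  using assms(3-)
proof (induction "card B" arbitrary: A B t rule: less_induct)
  case less
  note sub = \<open>A \<subseteq> carrier R\<close> \<open>B \<subseteq> carrier R\<close>
  have fin: "finite A" "finite B"
    using sub finite_carrier by (auto intro: finite_subset)
  let ?W = "real (card (carrier R))"
  let ?r = "\<lambda>A B x. convolution R (indicator A) (indicator B) x :: real"
  consider "t = 0" | "t > 0" "card A + card B - t \<ge> ?W"
    | (transform) g where "t > 0" "card A + card B - t < ?W" "g \<in> carrier R"
        "A \<inter> (\<lambda>b. b \<oplus> g) ` B \<noteq> {}" "\<not> (\<lambda>b. b \<oplus> g) ` B \<subseteq> A"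
    | (coset) "t > 0" "\<And>g. g \<in> carrier R \<Longrightarrow>
        A \<inter> (\<lambda>b. b \<oplus> g) ` B \<noteq> {} \<Longrightarrow> (\<lambda>b. b \<oplus> g) ` B \<subseteq> A"
    using \<open>0 \<le> t\<close> by fastforce
  then show ?case
  proof cases
    case 1
    then show ?thesis
      using convolution_indicator_nonneg by simp
  next
    case 2
    \<comment> \<open>By pigeonhole no value is below \<open>t\<close>, so the truncated sum is as
      large as it can be.\<close>
    have "min t (?r A B x) = t" if "x \<in> carrier R" for x
      using convolution_indicator_ge[OF sub that] 2 by simp
    then have "(\<Sum>x\<in>carrier R. min t (?r A B x)) = t * ?W"
      by simp
    then show ?thesis
      using \<open>t > 0\<close> by (simp add: mult_left_mono)
  next
    case (transform g)
    define C where "C = (\<lambda>b. b \<oplus> g) ` B"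
    have C: "C \<subseteq> carrier R" "card C = card B" "finite C"
      using sub transform card_translate fin by (auto simp: C_def)
    have sum_eq: "(\<Sum>x\<in>carrier R. min t (?r A B x)) = (\<Sum>x\<in>carrier R. min t (?r A C x))"
    proof -
      have "(\<Sum>x\<in>carrier R. min t (?r A C x)) = (\<Sum>x\<in>carrier R. min t (?r A B (x \<ominus> g)))"
        unfolding C_def using sub transform by (simp add: convolution_indicator_translate)
      then show ?thesis
        using sum_minus_right[OF \<open>g \<in> carrier R\<close>, of "\<lambda>x. min t (?r A B x)"] by simp
    qed
    \<comment> \<open>Since \<open>i\<close> lies strictly between 0 and \<open>card B\<close>, both
      \<open>A \<inter> C\<close> and \<open>C - A\<close> are smaller than \<open>B\<close>, and
      either may be the second set in the induction hypothesis.\<close>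
    define i where "i = card (A \<inter> C)"
    have "A \<inter> C \<subset> C"
      using transform by (auto simp: C_def)
    then have i: "0 < i" "i < card B"
      using transform C fin psubset_card_mono[of C "A \<inter> C"]
      by (auto simp: i_def C_def card_gt_0_iff)
    have "card A + card C = card (A \<union> C) + i"
      unfolding i_def by (rule card_Un_Int) (use fin C in auto)
    then have union: "real (card (A \<union> C)) = real (card A) + real (card B) - real i"
      using C by linarith
    have diff: "real (card (A - C)) = real (card A) - real i"
      "real (card (C - A)) = real (card B) - real i"
      using card_Int_Diff[of A C] card_Int_Diff[of C A] fin C by (auto simp: i_def Int_commute)
    show ?thesis
    proof (cases "t \<le> i")
      case True
      \<comment> \<open>The pair \<open>A \<union> C\<close>, \<open>A \<inter> C\<close> has the
        same total size as \<open>A\<close>, \<open>B\<close>, so the induction hypothesis gives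
        exactly the required bound; the other Dyson term is nonnegative and is dropped.\<close>
      have "t * min ?W (card (A \<union> C) + real (card (A \<inter> C)) - t - D)
          \<le> (\<Sum>x\<in>carrier R. min t (?r (A \<union> C) (A \<inter> C) x))"
      proof (rule less.hyps)
        show "card (A \<inter> C) < card B" "t \<le> card (A \<inter> C)"
          using i True by (auto simp: i_def)
        show "t \<le> card (A \<union> C)"
          using union i \<open>t \<le> card A\<close> by linarith
      qed (use C sub \<open>0 \<le> t\<close> in auto)
      also have "\<dots> \<le> (\<Sum>x\<in>carrier R. min t (?r A C x))"
      proof (rule sum_mono)
        fix x assume "x \<in> carrier R"
        from convolution_indicator_Dyson[OF this, of A C]
          convolution_indicator_nonneg[of "A - C" "C - A" x]
        show "min t (?r (A \<union> C) (A \<inter> C) x) \<le> min t (?r A C x)"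
          by linarith
      qed
      finally show ?thesis
        using sum_eq union by (simp add: i_def)
    next
      case False
      have "t * min ?W (card A + real (card B) - t - D) \<le> t * (card A + card B - t - D)"
        using \<open>t > 0\<close> by (intro mult_left_mono) auto
      \<comment> \<open>The right side exceeds the left by exactly \<open>i * D\<close>.\<close>
      also have "\<dots> \<le> real i * (card A + card B - real i)
          + (t - i) * (card A + card B - real i - t - D)"
        using D(1) by (simp add: algebra_simps)
      \<comment> \<open>The first Dyson term never exceeds \<open>i\<close>, so it is summed in
        full, giving \<open>i\<close> times \<open>card (A \<union> C)\<close>. The minimum in the
        second is not \<open>?W\<close>, because \<open>card A + card B - t < ?W\<close>.\<close>
      also have "\<dots> = (\<Sum>x\<in>carrier R. ?r (A \<union> C) (A \<inter> C) x)
          + (t - i) * min ?W (card (A - C) + real (card (C - A)) - (t - i) - D)"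
      proof -
        have "(\<Sum>x\<in>carrier R. ?r (A \<union> C) (A \<inter> C) x) = i * (card A + card B - real i)"
          by (subst sum_convolution_indicator) (use C sub union in \<open>auto simp: i_def mult.commute\<close>)
        moreover have "min ?W (card (A - C) + real (card (C - A)) - (t - i) - D)
            = card A + card B - real i - t - D"
          using diff D(1) transform(2) by simp
        ultimately show ?thesis by simp
      qed
      also have "\<dots> \<le> (\<Sum>x\<in>carrier R. ?r (A \<union> C) (A \<inter> C) x)
          + (\<Sum>x\<in>carrier R. min (t - i) (?r (A - C) (C - A) x))"
      proof (rule add_left_mono, rule less.hyps)
        show "card (C - A) < card B"
          using diff i by linarith
      qed (use C sub diff False \<open>t \<le> card A\<close> \<open>t \<le> card B\<close> in auto)
      also have "\<dots> \<le> (\<Sum>x\<in>carrier R. min t (?r A C x))"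
        unfolding sum.distrib[symmetric]
      proof (rule sum_mono)
        fix x assume x: "x \<in> carrier R"
        have "?r (A \<union> C) (A \<inter> C) x \<le> i"
          unfolding i_def by (rule convolution_indicator_le_card) (use x C sub in auto)
        with convolution_indicator_Dyson[OF x, of A C]
        show "?r (A \<union> C) (A \<inter> C) x + min (t - i) (?r (A - C) (C - A) x) \<le> min t (?r A C x)"
          by linarith
      qed
      finally show ?thesis
        using sum_eq by simp
    qed
  next
    case coset
    define H where "H = {h \<in> carrier R. \<forall>x\<in>carrier R. x \<oplus> h \<in> A \<longleftrightarrow> x \<in> A}"
    have H: "additive_subgroup H R"
      unfolding H_def by (rule additive_subgroup_stabilizer[OF sub(1)])
    have "A \<noteq> {}" "B \<noteq> {}"
      using \<open>t > 0\<close> \<open>t \<le> card B\<close> \<open>t \<le> card A\<close> by auto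
    then obtain b0 where b0: "b0 \<in> B" "b0 \<in> carrier R"
      using sub by blast
    have BH: "b \<ominus> b0 \<in> H" if b: "b \<in> B" for b
    proof -
      have b_carrier: "b \<in> carrier R" using b sub by auto
      \<comment> \<open>The translate of \<open>B\<close> by \<open>x \<ominus> b0\<close> contains
        both points, as the images of \<open>b\<close> and \<open>b0\<close>. If one of them is in
        \<open>A\<close>, the translate meets \<open>A\<close> and hence lies in it.\<close>
      have "x \<oplus> (b \<ominus> b0) \<in> A \<longleftrightarrow> x \<in> A" if x: "x \<in> carrier R" for x
      proof -
        have shift: "b \<oplus> (x \<ominus> b0) = x \<oplus> (b \<ominus> b0)" "b0 \<oplus> (x \<ominus> b0) = x"
          using x b_carrier b0 by (simp_all add: minus_eq a_ac r_neg a_lcomm[of b0 x])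
        then have "x \<oplus> (b \<ominus> b0) \<in> (\<lambda>b. b \<oplus> (x \<ominus> b0)) ` B" "x \<in> (\<lambda>b. b \<oplus> (x \<ominus> b0)) ` B"
          using b b0 by (metis imageI)+
        then show ?thesis
          using coset(2)[of "x \<ominus> b0"] x b0 by blast
      qed
      with b_carrier b0 show ?thesis
        by (simp add: H_def)
    qed
    have "card B = card ((\<lambda>b. b \<oplus> \<ominus> b0) ` B)"
      using card_translate[of B "\<ominus> b0"] sub b0 by simp
    also have "\<dots> \<le> card H"
      using BH by (intro card_mono) (auto simp: H_def minus_eq)
    finally have "card B \<le> card H" .
    \<comment> \<open>If \<open>H\<close> is the whole group, the nonempty set \<open>A\<close> is
      everything. Otherwise \<open>card B \<le> card H \<le> D\<close>, so the error term absorbs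
      \<open>card B\<close>.\<close>
    have bound: "min ?W (real (card A) + real (card B) - t - D) \<le> card A"
    proof (cases "H = carrier R")
      case True
      obtain a where "a \<in> A" using \<open>A \<noteq> {}\<close> by blast
      have "x \<in> A" if "x \<in> carrier R" for x
      proof -
        have "a \<in> carrier R"
          using \<open>a \<in> A\<close> sub by blast
        then have "x \<oplus> (a \<ominus> x) = a" "a \<ominus> x \<in> H"
          using that True by (simp_all add: minus_eq a_lcomm[of x a] r_neg)
        moreover from this(2) have "x \<oplus> (a \<ominus> x) \<in> A \<longleftrightarrow> x \<in> A"
          using that unfolding H_def by blast
        ultimately show ?thesis
          using \<open>a \<in> A\<close> by simp
      qed
      then have "A = carrier R" using sub by auto
      then show ?thesis by simp
    next
      case False
      then show ?thesis
        using D(2)[OF H] \<open>card B \<le> card H\<close> \<open>t > 0\<close> by linarith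
    qed
    \<comment> \<open>The points \<open>x \<ominus> b\<close> with \<open>b\<close> in
      \<open>B\<close> differ from \<open>x \<ominus> b0\<close> by elements of \<open>H\<close>, so
      all of them lie in \<open>A\<close>. Thus the translate of \<open>A\<close> by
      \<open>b0\<close> alone contributes \<open>t * card A\<close> to the sum.\<close>
    have popular: "?r A B x = card B" if x: "x \<in> carrier R" "x \<ominus> b0 \<in> A" for x
    proof -
      have "x \<ominus> b \<in> A" if b: "b \<in> B" for b
      proof -
        have "b \<in> carrier R"
          using b sub by blast
        then have "(x \<ominus> b) \<oplus> (b \<ominus> b0) = x \<ominus> b0" "x \<ominus> b \<in> carrier R"
          using b0 x by (simp_all add: minus_eq a_assoc r_neg1)
        moreover from this(2) have "(x \<ominus> b) \<oplus> (b \<ominus> b0) \<in> A \<longleftrightarrow> x \<ominus> b \<in> A"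
          using BH[OF b] unfolding H_def by blast
        ultimately show ?thesis
          using x(2) by simp
      qed
      then have "indicator B y * indicator A (x \<ominus> y) = (indicator B y :: real)" for y
        by (auto simp: indicator_def)
      then have "(\<Sum>y\<in>carrier R. indicator B y * indicator A (x \<ominus> y)) = real (card B)"
        using sum_indicator_carrier[OF sub(2)] by (simp only:)
      then show ?thesis
        by (subst convolution_commute[OF x(1)]) (simp only: convolution_eq_sum[OF x(1)])
    qed
    have "t * min ?W (real (card A) + real (card B) - t - D) \<le> t * card A"
      using bound \<open>t > 0\<close> by (simp add: mult_left_mono)
    also have "\<dots> = (\<Sum>x\<in>carrier R. t * indicator A (x \<ominus> b0))"
      using b0 sub by (simp add: sum_distrib_left[symmetric] sum_minus_right sum_indicator_carrier)
    also have "\<dots> \<le> (\<Sum>x\<in>carrier R. min t (?r A B x))"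
    proof (rule sum_mono)
      fix x assume "x \<in> carrier R"
      then show "t * indicator A (x \<ominus> b0) \<le> min t (?r A B x)"
        using popular[of x] \<open>t > 0\<close> \<open>t \<le> card B\<close> convolution_indicator_nonneg[of A B x]
        by (cases "x \<ominus> b0 \<in> A") auto
    qed
    finally show ?thesis .
  qed
qed

text \<open>In the truncated sum of \<open>Pollard\<close>, an unpopular \<open>x\<close>
  contributes less than \<open>e\<close> and a popular one at most \<open>t\<close>; solving for the
  number of popular \<open>x\<close> gives the bound.\<close>

lemma card_popular_sums_ge:
  fixes t D e :: real
  assumes D: "D \<ge> 0" "\<And>H. additive_subgroup H R \<Longrightarrow> H \<noteq> carrier R \<Longrightarrow> card H \<le> D"
    and AB: "A \<subseteq> carrier R" "B \<subseteq> carrier R" and t: "0 < t" "t \<le> card A" "t \<le> card B"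
    and e: "e \<ge> 0"
  shows "card {x \<in> carrier R. convolution R (indicator A) (indicator B) x \<ge> e}
    \<ge> min (card (carrier R)) (real (card A) + real (card B) - t - D)
      - e * card (carrier R) / t"
proof -
  let ?S = "{x \<in> carrier R. convolution R (indicator A) (indicator B) x \<ge> e}"
  let ?m = "min (real (card (carrier R))) (real (card A) + real (card B) - t - D)"
  have "t * ?m \<le> (\<Sum>x\<in>carrier R. min t (convolution R (indicator A) (indicator B) x))"
    using Pollard[OF D AB] t by simp
  also have "\<dots> \<le> (\<Sum>x\<in>carrier R. t * indicator ?S x + e)"
    by (rule sum_mono) (use e in \<open>auto simp: indicator_def\<close>)
  also have "\<dots> = t * card ?S + e * card (carrier R)"
    by (simp add: sum.distrib sum_distrib_left[symmetric] sum_indicator_carrier)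
  finally show ?thesis
    using t by (simp add: field_simps)
qed

end

section \<open>Subgroups and popular sums in the integers modulo \<open>W\<close>\<close>

lemma finite_abelian_group_residue_ring:
  assumes "W > 0"
  shows "finite_abelian_group (residue_ring (int W))"
proof (intro finite_abelian_group.intro finite_abelian_group_axioms.intro abelian_groupI)
  show "\<exists>y\<in>carrier (residue_ring (int W)).
      y \<oplus>\<^bsub>residue_ring (int W)\<^esub> x = \<zero>\<^bsub>residue_ring (int W)\<^esub>"
    if "x \<in> carrier (residue_ring (int W))" for x
    using assms by (intro bexI[of _ "(- x) mod int W"]) (simp_all add: residue_ring_def mod_simps)
  have "1 + z mod int W \<le> int W" for z
    using assms pos_mod_bound[of "int W" z] by linarith
  then show "x \<oplus>\<^bsub>residue_ring (int W)\<^esub> y \<in> carrier (residue_ring (int W))" for x y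
    using assms by (simp add: residue_ring_def)
qed (use assms in \<open>auto simp: residue_ring_def mod_simps algebra_simps\<close>)

lemma card_residue_ring: "card (carrier (residue_ring (int W))) = W"
  by (simp add: residue_ring_def)

text \<open>By Lagrange the index \<open>k\<close> divides \<open>W\<close>. As \<open>k\<close> is
  not 1, it has a prime factor \<open>p\<close>, which also divides \<open>W\<close>, and
  \<open>M \<le> p \<le> k\<close>.\<close>

lemma card_proper_subgroup_residue_ring:
  fixes M :: real
  assumes "W > 0" "M > 0" and M: "\<forall>p\<in>prime_factors W. real p \<ge> M"
    and H: "additive_subgroup H (residue_ring (int W))" "H \<noteq> carrier (residue_ring (int W))"
  shows "card H \<le> W / M"
proof -
  let ?R = "residue_ring (int W)"
  interpret finite_abelian_group ?R
    by (rule finite_abelian_group_residue_ring[OF \<open>W > 0\<close>])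
  have subgroup: "subgroup H (add_monoid ?R)"
    using H by (simp add: additive_subgroup_def)
  have "H \<subset> carrier ?R"
    using additive_subgroup.a_subset[OF H(1)] H(2) by auto
  then have less: "card H < W"
    using psubset_card_mono[of "carrier ?R" H] by (simp add: card_residue_ring)
  obtain k where k: "W = k * card H"
    using add.lagrange[OF subgroup] by (metis card_residue_ring order_def partial_object.select_convs(1))
  with less have "k \<noteq> 1" by auto
  then obtain p where p: "prime p" "p dvd k"
    by (metis prime_factor_nat)
  then have "p \<in> prime_factors W"
    using k \<open>W > 0\<close> by (auto simp: prime_factors_dvd)
  moreover have "p \<le> k"
    using p k \<open>W > 0\<close> by (auto intro!: dvd_imp_le)
  ultimately have "M \<le> k"
    using M by force
  then have "M * card H \<le> W"
    by (subst k) (simp add: mult_right_mono)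
  then show ?thesis
    using \<open>M > 0\<close> by (simp add: field_simps)
qed

text \<open>Any density \<gamma> below the ideal \<open>min 1 (\<alpha> + \<beta>)\<close> is
  reached by popular sums, with constants independent of \<open>W\<close>, \<open>A\<close> and
  \<open>B\<close>.\<close>

lemma popular_sums_residue_ring:
  fixes \<alpha> \<beta> \<gamma> :: real
  assumes "0 < \<alpha>" "0 < \<beta>" "\<gamma> < min 1 (\<alpha> + \<beta>)"
  shows "\<exists>e M. e > 0 \<and> M > 0 \<and> (\<forall>W A B. W > 0 \<longrightarrow> (\<forall>p\<in>prime_factors W. real p \<ge> M) \<longrightarrow>
    A \<subseteq> carrier (residue_ring (int W)) \<longrightarrow> B \<subseteq> carrier (residue_ring (int W)) \<longrightarrow>
    card A \<ge> \<alpha> * W \<longrightarrow> card B \<ge> \<beta> * W \<longrightarrow>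
    card {x \<in> carrier (residue_ring (int W)).
      convolution (residue_ring (int W)) (indicator A) (indicator B) x \<ge> e * W} \<ge> \<gamma> * W)"
proof -
  \<comment> \<open>\<open>card_popular_sums_ge\<close> loses \<open>t\<close>, \<open>D\<close> and
    the cost of unpopular points; each will be \<tau> * W, hence the division by 3. The bounds by
    \<alpha> and \<beta> ensure that \<open>t\<close> is at most both cardinalities.\<close>
  define \<tau> where "\<tau> = min (min \<alpha> \<beta>) ((min 1 (\<alpha> + \<beta>) - \<gamma>) / 3)"
  have \<tau>: "\<tau> > 0" "\<tau> \<le> \<alpha>" "\<tau> \<le> \<beta>" "3 * \<tau> \<le> min 1 (\<alpha> + \<beta>) - \<gamma>"
  proof -
    have "\<tau> \<le> (min 1 (\<alpha> + \<beta>) - \<gamma>) / 3"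
      unfolding \<tau>_def by (rule min.cobounded2)
    then show "3 * \<tau> \<le> min 1 (\<alpha> + \<beta>) - \<gamma>"
      by simp
  qed (use assms in \<open>auto simp: \<tau>_def\<close>)
  show ?thesis
  \<comment> \<open>With \<open>t = \<tau> * W\<close>, the popularity threshold
    \<open>\<tau>\<^sup>2 * W\<close> costs \<tau> * W; prime factors of at least 1 / \<tau> bound
    proper subgroups by \<tau> * W.\<close>
  proof (rule exI[of _ "\<tau>\<^sup>2"], rule exI[of _ "1 / \<tau>"], intro conjI allI impI)
    fix W :: nat and A B
    assume W: "W > 0" and M: "\<forall>p\<in>prime_factors W. real p \<ge> 1 / \<tau>"
      and AB: "A \<subseteq> carrier (residue_ring (int W))" "B \<subseteq> carrier (residue_ring (int W))"
        "card A \<ge> \<alpha> * W" "card B \<ge> \<beta> * W"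
    interpret finite_abelian_group "residue_ring (int W)"
      by (rule finite_abelian_group_residue_ring[OF W])
    have D: "card H \<le> \<tau> * W" if "additive_subgroup H (residue_ring (int W))"
      "H \<noteq> carrier (residue_ring (int W))" for H
      using card_proper_subgroup_residue_ring[OF W _ M that] \<tau>(1) by (simp add: mult.commute)
    have "\<tau> * W \<le> \<alpha> * W" "\<tau> * W \<le> \<beta> * W"
      using \<tau> by (auto intro: mult_right_mono)
    then have t: "0 < \<tau> * W" "\<tau> * W \<le> card A" "\<tau> * W \<le> card B"
      using \<tau>(1) W AB(3,4) by (simp, linarith+)
    have "\<gamma> * W \<le> (min 1 (\<alpha> + \<beta> - 2 * \<tau>) - \<tau>) * W"
      using \<tau> by (intro mult_right_mono) auto
    also have "\<dots> = min W (\<alpha> * W + \<beta> * W - 2 * \<tau> * W) - \<tau> * W"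
      using W by (simp add: min_mult_distrib_left min_mult_distrib_right algebra_simps)
    also have "\<dots> \<le> min W (real (card A) + real (card B) - \<tau> * W - \<tau> * W) - \<tau>\<^sup>2 * W * W / (\<tau> * W)"
      using AB W \<tau>(1) by (auto simp: power2_eq_square)
    also have "\<dots> \<le> card {x \<in> carrier (residue_ring (int W)).
      convolution (residue_ring (int W)) (indicator A) (indicator B) x \<ge> \<tau>\<^sup>2 * W}"
      using card_popular_sums_ge[OF _ D AB(1,2) t, of "\<tau>\<^sup>2 * W"] \<tau>(1)
      by (simp add: card_residue_ring)
    finally show "\<gamma> * W \<le> card {x \<in> carrier (residue_ring (int W)).
      convolution (residue_ring (int W)) (indicator A) (indicator B) x \<ge> \<tau>\<^sup>2 * W}" .
  qed (use \<tau> in auto)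
qed

section \<open>Iterated convolutions and induction on the number of sets\<close>

lemma iterated_convolution_1 [simp]: "iterated_convolution R (Suc 0) f = f 1"
  by (simp add: iterated_convolution_def)

lemma iterated_convolution_Suc:
  "k \<ge> 1 \<Longrightarrow> iterated_convolution R (Suc k) f = convolution R (iterated_convolution R k f) (f (Suc k))"
  by (simp add: iterated_convolution_def)

lemma iterated_convolution_nonneg:
  assumes "k \<ge> 1" "\<And>j y. f j y \<ge> 0"
  shows "iterated_convolution R k f x \<ge> 0"
  using assms(1)
proof (induction k arbitrary: x rule: dec_induct)
  case (step k)
  then show ?case
    using assms(2) by (auto simp: iterated_convolution_Suc convolution_def intro!: sum_nonneg)
qed (use assms(2) in simp)

text \<open>The \<open>k\<close>-fold convolution dominates \<open>c\<close> times the indicator of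
  its superlevel set: by definition on that set, by nonnegativity off it. Convolving with a
  nonnegative function preserves this.\<close>

lemma iterated_convolution_Suc_ge:
  fixes c :: real
  assumes "k \<ge> 1" "\<And>j y. f j y \<ge> 0"
  shows "iterated_convolution R (Suc k) f x
    \<ge> c * convolution R (indicator {y \<in> carrier R. iterated_convolution R k f y \<ge> c}) (f (Suc k)) x"
  unfolding iterated_convolution_Suc[OF assms(1)] convolution_def sum_distrib_left
  using assms iterated_convolution_nonneg[of k f R]
  by (intro sum_mono) (auto simp: indicator_def intro!: mult_right_mono)

text \<open>Induction adding one set at a time: the popular values for \<open>k\<close> sets are the
  first set in \<open>popular_sums_residue_ring\<close>. The density \<gamma> stays arbitrary
  because the step uses the hypothesis at another density.\<close>

lemma popular_iterated_sums:
  fixes \<theta> :: "nat \<Rightarrow> real" and \<gamma> :: real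
  assumes "1 \<le> k" "\<And>j. j \<in> {1..k} \<Longrightarrow> 0 < \<theta> j" "\<gamma> < min 1 (\<Sum>j = 1..k. \<theta> j)"
  shows "\<exists>c M. c > 0 \<and> M > 0 \<and> (\<forall>(W :: nat) A. W > 0 \<longrightarrow>
    (\<forall>p\<in>prime_factors W. real p \<ge> M) \<longrightarrow>
    (\<forall>j\<in>{1..k}. A j \<subseteq> carrier (residue_ring (int W)) \<and> card (A j) \<ge> \<theta> j * W) \<longrightarrow>
    card {x \<in> carrier (residue_ring (int W)).
      iterated_convolution (residue_ring (int W)) k (\<lambda>j. indicator (A j)) x \<ge> c * real W ^ (k - 1)}
      \<ge> \<gamma> * W)"
  using assms
proof (induction k arbitrary: \<gamma> rule: dec_induct)
  case base
  \<comment> \<open>For one set the constants \<open>c = M = 1\<close> serve: the power of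
    \<open>W\<close> is 1 and the popular values are \<open>A 1\<close> itself.\<close>
  have "{x \<in> carrier (residue_ring (int W)). indicator (A 1) x \<ge> (1 :: real)} = A 1"
    if "A 1 \<subseteq> carrier (residue_ring (int W))" for W and A :: "nat \<Rightarrow> int set"
    using that by (auto simp: indicator_def split: if_splits)
  moreover have "\<gamma> * real W \<le> \<theta> 1 * real W" for W
    using base by (intro mult_right_mono) auto
  ultimately show ?case
    by (intro exI[of _ 1]) (auto intro: order_trans[rotated])
next
  case (step k)
  let ?\<sigma> = "\<Sum>j = 1..k. \<theta> j"
  have pos: "0 < \<theta> (Suc k)" "0 < ?\<sigma>"
    using step.prems step.hyps by (auto intro!: sum_pos)
  have "\<gamma> < min 1 (?\<sigma> + \<theta> (Suc k))"
    using step.prems by simp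
  then have "max 0 (\<gamma> - \<theta> (Suc k)) < min 1 ?\<sigma>"
    using pos by auto
  \<comment> \<open>\<alpha> is the density for the first \<open>k\<close> sets: small enough for
    the induction hypothesis, positive as \<open>popular_sums_residue_ring\<close> demands, and so
    large that adding \<open>\<theta> (Suc k)\<close> exceeds \<gamma>.\<close>
  then obtain \<alpha> where \<alpha>: "max 0 (\<gamma> - \<theta> (Suc k)) < \<alpha>" "\<alpha> < min 1 ?\<sigma>"
    using dense by blast
  have "0 < \<theta> j" if "j \<in> {1..k}" for j
    using step.prems(1) that by simp
  from step.IH[OF this \<alpha>(2)] obtain c M where cM: "c > 0" "M > 0"
    "\<And>(W :: nat) A. W > 0 \<Longrightarrow> \<forall>p\<in>prime_factors W. real p \<ge> M \<Longrightarrow>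
      \<forall>j\<in>{1..k}. A j \<subseteq> carrier (residue_ring (int W)) \<and> card (A j) \<ge> \<theta> j * W \<Longrightarrow>
      card {x \<in> carrier (residue_ring (int W)).
        iterated_convolution (residue_ring (int W)) k (\<lambda>j. indicator (A j)) x \<ge> c * real W ^ (k - 1)}
        \<ge> \<alpha> * W"
    by auto
  have "\<gamma> < min 1 (\<alpha> + \<theta> (Suc k))"
    using \<alpha> \<open>\<gamma> < min 1 (?\<sigma> + \<theta> (Suc k))\<close> by auto
  from popular_sums_residue_ring[OF _ pos(1) this] \<alpha> obtain e M' where e: "e > 0" "M' > 0"
    "\<And>W A B. W > 0 \<Longrightarrow> \<forall>p\<in>prime_factors W. real p \<ge> M' \<Longrightarrow>
      A \<subseteq> carrier (residue_ring (int W)) \<Longrightarrow> B \<subseteq> carrier (residue_ring (int W)) \<Longrightarrow>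
      card A \<ge> \<alpha> * W \<Longrightarrow> card B \<ge> \<theta> (Suc k) * W \<Longrightarrow>
      card {x \<in> carrier (residue_ring (int W)).
        convolution (residue_ring (int W)) (indicator A) (indicator B) x \<ge> e * W} \<ge> \<gamma> * W"
    by auto
  show ?case
  proof (rule exI[of _ "c * e"], rule exI[of _ "max M M'"], intro conjI allI impI)
    fix W :: nat and A :: "nat \<Rightarrow> int set"
    let ?R = "residue_ring (int W)" and ?f = "\<lambda>j. indicator (A j) :: int \<Rightarrow> real"
    assume W: "W > 0" and M: "\<forall>p\<in>prime_factors W. real p \<ge> max M M'"
      and A: "\<forall>j\<in>{1..Suc k}. A j \<subseteq> carrier ?R \<and> card (A j) \<ge> \<theta> j * W"
    define S where "S = {x \<in> carrier ?R. iterated_convolution ?R k ?f x \<ge> c * real W ^ (k - 1)}"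
    have "\<gamma> * W \<le> card {x \<in> carrier ?R. convolution ?R (indicator S) (?f (Suc k)) x \<ge> e * W}"
    proof (rule e(3))
      show "\<alpha> * W \<le> card S"
        unfolding S_def by (rule cM(3)) (use W M A in auto)
    qed (use W M A in \<open>auto simp: S_def\<close>)
    also have "\<dots> \<le> card {x \<in> carrier ?R.
        iterated_convolution ?R (Suc k) ?f x \<ge> c * e * real W ^ (Suc k - 1)}"
    proof (intro of_nat_mono card_mono subsetI)
      fix x assume "x \<in> {x \<in> carrier ?R. convolution ?R (indicator S) (?f (Suc k)) x \<ge> e * W}"
      then have x: "x \<in> carrier ?R" "convolution ?R (indicator S) (?f (Suc k)) x \<ge> e * W"
        by auto
      have "c * e * real W ^ (Suc k - 1) = c * real W ^ (k - 1) * (e * W)"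
        using \<open>1 \<le> k\<close> by (cases k) auto
      also have "\<dots> \<le> c * real W ^ (k - 1) * convolution ?R (indicator S) (?f (Suc k)) x"
        using x cM(1) by (intro mult_left_mono) auto
      also have "\<dots> \<le> iterated_convolution ?R (Suc k) ?f x"
        unfolding S_def by (rule iterated_convolution_Suc_ge) (use \<open>1 \<le> k\<close> in auto)
      finally show "x \<in> {x \<in> carrier ?R.
          iterated_convolution ?R (Suc k) ?f x \<ge> c * e * real W ^ (Suc k - 1)}"
        using x by simp
    qed (rule finite_subset[of _ "{0..<int W}"], auto simp: residue_ring_def)
    finally show "\<gamma> * W \<le> card {x \<in> carrier ?R.
        iterated_convolution ?R (Suc k) ?f x \<ge> c * e * real W ^ (Suc k - 1)}" .
  qed (use cM e in auto)
qed

theorem theorem4p1: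
  fixes s :: nat and \<theta> :: "nat \<Rightarrow> real"
  assumes "s \<ge> 2"
    and "\<forall>j\<in>{1..s}. 0 < \<theta> j \<and> \<theta> j \<le> 1"
    and "(\<Sum>j = 1..s. \<theta> j) > 1"
  shows "\<exists>c M :: real. c > 0 \<and> M > 0 \<and>
    (\<forall>(W :: nat) (A :: nat \<Rightarrow> int set).
       W > 0 \<longrightarrow>
       (\<forall>p\<in>prime_factors W. real p \<ge> M) \<longrightarrow>
       (\<forall>j\<in>{1..s}. A j \<subseteq> carrier (residue_ring (int W)) \<and> real (card (A j)) \<ge> \<theta> j * real W) \<longrightarrow>
       (\<forall>x\<in>carrier (residue_ring (int W)).
          iterated_convolution (residue_ring (int W)) s (\<lambda>j. indicator (A j)) x
            \<ge> c * real W ^ (s - 1)))"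
proof -
  obtain k where k: "s = Suc k" "k \<ge> 1"
    using assms(1) by (cases s) auto
  have "1 - \<theta> s < min 1 (\<Sum>j = 1..k. \<theta> j)"
    using assms k by auto
  \<comment> \<open>The room for \<gamma> is where the hypothesis that the densities sum to more
    than 1 enters.\<close>
  then obtain \<gamma> where \<gamma>: "1 - \<theta> s < \<gamma>" "\<gamma> < min 1 (\<Sum>j = 1..k. \<theta> j)"
    using dense by blast
  have "0 < \<theta> j" if "j \<in> {1..k}" for j
    using that assms(2) k by auto
  from popular_iterated_sums[OF k(2) this \<gamma>(2)] obtain c M where cM: "c > 0" "M > 0"
    "\<And>(W :: nat) A. W > 0 \<Longrightarrow> \<forall>p\<in>prime_factors W. real p \<ge> M \<Longrightarrow>
      \<forall>j\<in>{1..k}. A j \<subseteq> carrier (residue_ring (int W)) \<and> card (A j) \<ge> \<theta> j * W \<Longrightarrow>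
      card {x \<in> carrier (residue_ring (int W)).
        iterated_convolution (residue_ring (int W)) k (\<lambda>j. indicator (A j)) x \<ge> c * real W ^ (k - 1)}
        \<ge> \<gamma> * W"
    by auto
  show ?thesis
  \<comment> \<open>Pigeonhole gives at least \<open>(\<gamma> + \<theta> s - 1) * W\<close>
    representations of \<open>x\<close> by a popular value and an element of \<open>A s\<close>,
    each of weight at least \<open>c * W ^ (k - 1)\<close>.\<close>
  proof (rule exI[of _ "c * (\<gamma> + \<theta> s - 1)"], rule exI[of _ M], intro conjI allI impI ballI)
    show "c * (\<gamma> + \<theta> s - 1) > 0" "M > 0"
      using cM \<gamma> by auto
    fix W :: nat and A :: "nat \<Rightarrow> int set" and x
    let ?R = "residue_ring (int W)" and ?f = "\<lambda>j. indicator (A j) :: int \<Rightarrow> real"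
    assume W: "W > 0" and M: "\<forall>p\<in>prime_factors W. real p \<ge> M"
      and A: "\<forall>j\<in>{1..s}. A j \<subseteq> carrier ?R \<and> real (card (A j)) \<ge> \<theta> j * real W"
      and x: "x \<in> carrier ?R"
    interpret finite_abelian_group ?R
      by (rule finite_abelian_group_residue_ring[OF W])
    define S where "S = {x \<in> carrier ?R. iterated_convolution ?R k ?f x \<ge> c * real W ^ (k - 1)}"
    have "\<gamma> * W \<le> card S"
      unfolding S_def by (rule cM(3)) (use W M A k in auto)
    moreover have "real (card (A s)) \<ge> \<theta> s * W"
      using A k by auto
    moreover have "convolution ?R (indicator S) (?f s) x \<ge> real (card S) + real (card (A s)) - W"
      using convolution_indicator_ge[of S "A s" x] x A k by (auto simp: S_def card_residue_ring)
    ultimately have "(\<gamma> + \<theta> s - 1) * W \<le> convolution ?R (indicator S) (?f s) x"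
      by (simp add: algebra_simps)
    then have "c * real W ^ (k - 1) * ((\<gamma> + \<theta> s - 1) * W)
        \<le> c * real W ^ (k - 1) * convolution ?R (indicator S) (?f s) x"
      using cM(1) by (intro mult_left_mono) auto
    also have "\<dots> \<le> iterated_convolution ?R s ?f x"
      unfolding S_def k(1) by (rule iterated_convolution_Suc_ge) (use k in auto)
    also have "c * real W ^ (k - 1) * ((\<gamma> + \<theta> s - 1) * W) = c * (\<gamma> + \<theta> s - 1) * real W ^ (s - 1)"
      using k by (cases k) auto
    finally show "c * (\<gamma> + \<theta> s - 1) * real W ^ (s - 1) \<le> iterated_convolution ?R s ?f x" .
  qed
qed

end
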